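(* Let $G$ be a simple connected graph of order $n$ and minimum degree $\delta$, and let $q_2=q(K_{\delta}\vee(K_2\cup K_{n-\delta-2}))$. If $q(G)\geq q_2$, then $G$ is super-$\kappa$.
   Context: $q(H)$ denotes the $Q$-index of a graph $H$, the largest eigenvalue of $D(H)+A(H)$ ($D$ = diagonal degree matrix, $A$ = adjacency matrix). $G\vee H$ is the join, $G\cup H$ the disjoint union, $K_r$ the complete graph on $r$ vertices. A vertex subset $C$ of a connected graph $G$ is a vertex-cut if $G-C$ is disconnected or $G-C=K_1$; $\kappa(G)$ is the minimum size of a vertex-cut, and a vertex-cut is minimum if it has size $\kappa(G)$. $G$ is super-$\kappa$ (super-connected) if every minimum vertex-cut isolates a vertex of minimum degree. *)

theory Defs
  imports "Jordan_Normal_Form.Char_Poly" "HOL-Library.Countable_Set"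
begin

section \<open>Finite simple graphs\<close>

record 'a sgraph =
  verts :: "'a set"
  edges :: "'a set set"

definition simple_graph :: "'a sgraph \<Rightarrow> bool" where
  "simple_graph G \<longleftrightarrow> finite (verts G) \<and> (\<forall>e\<in>edges G. e \<subseteq> verts G \<and> card e = 2)"

definition adjacent :: "'a sgraph \<Rightarrow> 'a \<Rightarrow> 'a \<Rightarrow> bool" where
  "adjacent G u v \<longleftrightarrow> {u, v} \<in> edges G"

definition vdegree :: "'a sgraph \<Rightarrow> 'a \<Rightarrow> nat" where
  "vdegree G v = card {u \<in> verts G. adjacent G v u}"

definition min_degree :: "'a sgraph \<Rightarrow> nat" where
  "min_degree G = Min (vdegree G ` verts G)"

definition complete_graph :: "nat \<Rightarrow> nat sgraph" where
  "complete_graph r = \<lparr>verts = {..<r}, edges = {e. e \<subseteq> {..<r} \<and> card e = 2}\<rparr>"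

definition disjoint_union :: "'a sgraph \<Rightarrow> 'b sgraph \<Rightarrow> ('a + 'b) sgraph" where
  "disjoint_union G H =
    \<lparr>verts = verts G <+> verts H,
     edges = (\<lambda>e. Inl ` e) ` edges G \<union> (\<lambda>e. Inr ` e) ` edges H\<rparr>"

definition graph_join :: "'a sgraph \<Rightarrow> 'b sgraph \<Rightarrow> ('a + 'b) sgraph" where
  "graph_join G H =
    \<lparr>verts = verts G <+> verts H,
     edges = (\<lambda>e. Inl ` e) ` edges G \<union> (\<lambda>e. Inr ` e) ` edges H
       \<union> {{Inl u, Inr v} | u v. u \<in> verts G \<and> v \<in> verts H}\<rparr>"

definition delete_verts :: "'a sgraph \<Rightarrow> 'a set \<Rightarrow> 'a sgraph" where
  "delete_verts G C = \<lparr>verts = verts G - C, edges = {e \<in> edges G. e \<inter> C = {}}\<rparr>"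


section \<open>Connectivity and vertex-cuts\<close>

definition reachable :: "'a sgraph \<Rightarrow> 'a \<Rightarrow> 'a \<Rightarrow> bool" where
  "reachable G = (adjacent G)\<^sup>*\<^sup>*"

definition connected_graph :: "'a sgraph \<Rightarrow> bool" where
  "connected_graph G \<longleftrightarrow> verts G \<noteq> {} \<and> (\<forall>u\<in>verts G. \<forall>v\<in>verts G. reachable G u v)"

text \<open>The graph without vertices is neither connected nor disconnected, so the full vertex
  set is never a vertex-cut.\<close>

definition disconnected_graph :: "'a sgraph \<Rightarrow> bool" where
  "disconnected_graph G \<longleftrightarrow> (\<exists>u\<in>verts G. \<exists>v\<in>verts G. \<not> reachable G u v)"

definition vertex_cut :: "'a sgraph \<Rightarrow> 'a set \<Rightarrow> bool" where
  "vertex_cut G C \<longleftrightarrow> C \<subseteq> verts G \<and>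
    (disconnected_graph (delete_verts G C) \<or> card (verts (delete_verts G C)) = 1)"

definition vertex_connectivity :: "'a sgraph \<Rightarrow> nat" where
  "vertex_connectivity G = (LEAST k. \<exists>C. vertex_cut G C \<and> card C = k)"

definition minimum_vertex_cut :: "'a sgraph \<Rightarrow> 'a set \<Rightarrow> bool" where
  "minimum_vertex_cut G C \<longleftrightarrow> vertex_cut G C \<and> card C = vertex_connectivity G"

definition isolates :: "'a sgraph \<Rightarrow> 'a set \<Rightarrow> 'a \<Rightarrow> bool" where
  "isolates G C v \<longleftrightarrow> v \<in> verts (delete_verts G C) \<and> vdegree (delete_verts G C) v = 0"

definition super_connected :: "'a sgraph \<Rightarrow> bool" where
  "super_connected G \<longleftrightarrow>
    (\<forall>C. minimum_vertex_cut G C \<longrightarrow> (\<exists>v. isolates G C v \<and> vdegree G v = min_degree G))"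


section \<open>The Q-index\<close>

text \<open>For finite \<open>verts G\<close>, the function \<open>from_nat_into (verts G)\<close> enumerates the vertices
  bijectively by \<open>{..<card (verts G)}\<close>. Another enumeration conjugates the matrices below by a
  permutation; the lemma \<open>eigenvalue_signless_laplacian_iff\<close> shows that the eigenvalues do not
  depend on this choice.\<close>

definition adjacency_mat :: "'a sgraph \<Rightarrow> real mat" where
  "adjacency_mat G = mat (card (verts G)) (card (verts G))
    (\<lambda>(i, j). if adjacent G (from_nat_into (verts G) i) (from_nat_into (verts G) j) then 1 else 0)"

definition degree_mat :: "'a sgraph \<Rightarrow> real mat" where
  "degree_mat G = mat (card (verts G)) (card (verts G))
    (\<lambda>(i, j). if i = j then real (vdegree G (from_nat_into (verts G) i)) else 0)"

definition signless_laplacian :: "'a sgraph \<Rightarrow> real mat" where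
  "signless_laplacian G = degree_mat G + adjacency_mat G"

definition Q_index :: "'a sgraph \<Rightarrow> real" where
  "Q_index G = Max {k. eigenvalue (signless_laplacian G) k}"

lemma finite_eigenvalues_signless_laplacian:
  "finite {k. eigenvalue (signless_laplacian G) k}"
proof -
  have c: "signless_laplacian G \<in> carrier_mat (card (verts G)) (card (verts G))"
    by (auto simp: signless_laplacian_def degree_mat_def adjacency_mat_def)
  have "char_poly (signless_laplacian G) \<noteq> 0"
    using degree_monic_char_poly[OF c] by auto
  then show ?thesis
    using poly_roots_finite by (simp add: eigenvalue_root_char_poly[OF c])
qed

lemma eigenvalue_signless_laplacian_iff:
  assumes "finite (verts G)"
  shows "eigenvalue (signless_laplacian G) k \<longleftrightarrow>
    (\<exists>x. (\<exists>v\<in>verts G. x v \<noteq> 0) \<and>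
      (\<forall>v\<in>verts G. real (vdegree G v) * x v + (\<Sum>u\<in>{u \<in> verts G. adjacent G v u}. x u) = k * x v))"
    (is "?L \<longleftrightarrow> ?R")
proof -
  define V where "V = verts G"
  define n where "n = card V"
  define f where "f = from_nat_into V"
  have fin: "finite V" using assms by (simp add: V_def)
  have bij: "bij_betw f {..<n} V"
    unfolding f_def n_def by (rule bij_betw_from_nat_into_finite[OF fin])
  have dim: "signless_laplacian G \<in> carrier_mat n n"
    by (auto simp: signless_laplacian_def degree_mat_def adjacency_mat_def n_def V_def)
  have row: "(signless_laplacian G *\<^sub>v w) $ i
      = real (vdegree G (f i)) * x (f i) + (\<Sum>u\<in>{u \<in> V. adjacent G (f i) u}. x u)"
    if i: "i < n" and w: "w \<in> carrier_vec n" and wx: "\<And>j. j < n \<Longrightarrow> w $ j = x (f j)" for w x i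
  proof -
    have "(signless_laplacian G *\<^sub>v w) $ i = (\<Sum>j\<in>{..<n}. signless_laplacian G $$ (i, j) * w $ j)"
      using i w dim by (auto simp: scalar_prod_def lessThan_atLeast0 intro!: sum.cong)
    also have "\<dots> = (\<Sum>j\<in>{..<n}. (if j = i then real (vdegree G (f i)) * x (f i) else 0)
        + (if adjacent G (f i) (f j) then x (f j) else 0))"
      using i wx by (intro sum.cong)
        (auto simp: signless_laplacian_def degree_mat_def adjacency_mat_def n_def V_def f_def algebra_simps)
    also have "\<dots> = real (vdegree G (f i)) * x (f i)
        + (\<Sum>j\<in>{..<n}. if adjacent G (f i) (f j) then x (f j) else 0)"
      using i by (simp add: sum.distrib)
    also have "(\<Sum>j\<in>{..<n}. if adjacent G (f i) (f j) then x (f j) else 0)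
        = (\<Sum>u\<in>V. if adjacent G (f i) u then x u else 0)"
      by (rule sum.reindex_bij_betw[OF bij])
    also have "\<dots> = (\<Sum>u\<in>{u \<in> V. adjacent G (f i) u}. x u)"
      using fin by (simp add: sum.inter_filter)
    finally show ?thesis .
  qed
  have fV: "f i \<in> V" if "i < n" for i using bij that by (auto simp: bij_betw_def)
  have Vf: "\<exists>i<n. v = f i" if "v \<in> V" for v
    using bij that by (auto simp: bij_betw_def)
  show ?thesis
  proof
    assume ?L
    then obtain w where w: "w \<in> carrier_vec n" and w0: "w \<noteq> 0\<^sub>v n"
      and ev: "signless_laplacian G *\<^sub>v w = k \<cdot>\<^sub>v w"
      using dim by (auto simp: eigenvalue_def eigenvector_def)
    define x where "x v = w $ the_inv_into {..<n} f v" for v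
    have wx: "w $ j = x (f j)" if "j < n" for j
      using bij that by (simp add: x_def the_inv_into_f_f bij_betw_def)
    obtain j where j: "j < n" "w $ j \<noteq> 0"
    proof (rule ccontr)
      assume "\<not> thesis"
      with that have "w $ i = 0" if "i < n" for i using \<open>i < n\<close> by blast
      then have "w = 0\<^sub>v n" using w by (intro eq_vecI) auto
      with w0 show False ..
    qed
    have "\<exists>v\<in>V. x v \<noteq> 0" using j wx fV by metis
    moreover have "real (vdegree G v) * x v + (\<Sum>u\<in>{u \<in> V. adjacent G v u}. x u) = k * x v"
      if "v \<in> V" for v
    proof -
      obtain i where i: "i < n" "v = f i" using Vf[OF \<open>v \<in> V\<close>] by auto
      show ?thesis using row[OF i(1) w wx] ev i w wx[OF i(1)] by simp
    qed
    ultimately show ?R unfolding V_def by blast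
  next
    assume ?R
    then obtain x v where v: "v \<in> V" "x v \<noteq> 0"
      and ev: "\<And>v. v \<in> V \<Longrightarrow>
        real (vdegree G v) * x v + (\<Sum>u\<in>{u \<in> V. adjacent G v u}. x u) = k * x v"
      unfolding V_def by blast
    define w where "w = vec n (\<lambda>j. x (f j))"
    have w: "w \<in> carrier_vec n" and wx: "\<And>j. j < n \<Longrightarrow> w $ j = x (f j)"
      by (auto simp: w_def)
    have "w \<noteq> 0\<^sub>v n" using Vf[OF v(1)] v(2) wx by auto
    moreover have "signless_laplacian G *\<^sub>v w = k \<cdot>\<^sub>v w"
    proof (rule eq_vecI)
      fix i assume "i < dim_vec (k \<cdot>\<^sub>v w)"
      then have i: "i < n" using w by simp
      show "(signless_laplacian G *\<^sub>v w) $ i = (k \<cdot>\<^sub>v w) $ i"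
        using row[OF i w wx] ev[OF fV[OF i]] i w wx[OF i] by simp
    qed (use dim w in auto)
    ultimately show ?L
      using dim w by (auto simp: eigenvalue_def eigenvector_def)
  qed
qed

end

theory Submission
  imports Defs "HOL-Analysis.Function_Topology"
begin

text \<open>If \<open>G\<close> is not super-\<open>\<kappa>\<close>, then some cut \<open>C\<close> with at most \<open>\<delta>\<close> vertices leaves only components
  with at least two vertices, so the rest splits into parts \<open>A\<close>, \<open>B\<close> without edges between them.
  Vertices of \<open>A \<union> B\<close> are moved into \<open>C\<close> until it has \<open>\<delta>\<close> elements. The graph \<open>H\<close> obtained by adding all
  edges except those between \<open>A\<close> and \<open>B\<close> is then a proper supergraph of \<open>G\<close>.
  Let \<open>x\<close> be the positive Perron vector of \<open>G\<close>. If \<open>A\<close> or \<open>B\<close> has two elements, \<open>H\<close> is a copy of the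
  extremal graph. Otherwise both can be kept at three or more elements: pairing three vertices of \<open>A\<close> with three vertices of \<open>B\<close>,
  two of the pairs compare in the same direction under \<open>x\<close>; separating the two smaller vertices from the
  rest of \<open>A \<union> B\<close> instead of \<open>A\<close> from \<open>B\<close> turns \<open>H\<close> into a copy of the extremal graph and does not decrease the sum of
  \<open>(x u + x v)\<^sup>2\<close> over the edges. Hence the Rayleigh quotient gives \<open>q(G) < q\<^sub>2\<close>.\<close>

section \<open>The quadratic form of the signless Laplacian\<close>

text \<open>Ordered pairs: each edge of a simple graph occurs twice, which is the source of the
  factors 2 in the energy identities and bounds.\<close>

definition edge_pairs :: "'a sgraph \<Rightarrow> ('a \<times> 'a) set" where
  "edge_pairs G = {(u, v). u \<in> verts G \<and> v \<in> verts G \<and> adjacent G u v}"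

text \<open>On the edge pairs of a finite graph this is twice the quadratic form of the signless
  Laplacian. Arbitrary sets of pairs are allowed, so that supergraphs on the same vertices and sets
  of cross pairs need not be built as graphs.\<close>

definition pair_energy :: "('a \<Rightarrow> real) \<Rightarrow> ('a \<times> 'a) set \<Rightarrow> real" where
  "pair_energy x S = (\<Sum>(u, v)\<in>S. (x u + x v)\<^sup>2)"

text \<open>The signless Laplacian acting on functions on the vertices, free of the enumeration
  behind the matrices.\<close>

definition Q_apply :: "'a sgraph \<Rightarrow> ('a \<Rightarrow> real) \<Rightarrow> 'a \<Rightarrow> real" where
  "Q_apply G x v = real (vdegree G v) * x v + (\<Sum>u\<in>{u \<in> verts G. adjacent G v u}. x u)"

lemma adjacent_commute: "adjacent G u v \<longleftrightarrow> adjacent G v u"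
  by (simp add: adjacent_def insert_commute)

lemma simple_graph_adjacentD:
  assumes "simple_graph G" "adjacent G u v"
  shows "u \<in> verts G" "v \<in> verts G" "u \<noteq> v"
proof -
  have "{u, v} \<subseteq> verts G" "card {u, v} = 2"
    using assms unfolding simple_graph_def adjacent_def by blast+
  then show "u \<in> verts G" "v \<in> verts G" "u \<noteq> v" by auto
qed

lemma finite_edge_pairs: "finite (verts G) \<Longrightarrow> finite (edge_pairs G)"
  by (rule finite_subset[of _ "verts G \<times> verts G"]) (auto simp: edge_pairs_def)

lemma edge_pairs_eq_Sigma:
  "edge_pairs G = Sigma (verts G) (\<lambda>u. {v \<in> verts G. adjacent G u v})"
  by (auto simp: edge_pairs_def)

lemma sum_edge_pairs_swap:
  "(\<Sum>(u, v)\<in>edge_pairs G. f u v) = (\<Sum>(u, v)\<in>edge_pairs G. f v u)"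
  by (rule sum.reindex_bij_witness[of _ "\<lambda>(u, v). (v, u)" "\<lambda>(u, v). (v, u)"])
    (auto simp: edge_pairs_def adjacent_commute)

text \<open>Reversing the pairs shows that the terms with \<open>z u\<close> and with
  \<open>z v\<close> contribute equally; grouping by the first vertex then gives
  \<open>Q_apply\<close>. The bilinear form serves to differentiate the energy in a direction
  \<open>z\<close>.\<close>

lemma polarized_energy_eq:
  assumes "finite (verts G)"
  shows "(\<Sum>(u, v)\<in>edge_pairs G. (x u + x v) * (z u + z v)) = 2 * (\<Sum>u\<in>verts G. z u * Q_apply G x u)"
proof -
  have "(\<Sum>(u, v)\<in>edge_pairs G. (x u + x v) * (z u + z v))
      = (\<Sum>(u, v)\<in>edge_pairs G. (x u + x v) * z u) + (\<Sum>(u, v)\<in>edge_pairs G. (x u + x v) * z v)"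
    by (simp add: sum.distrib[symmetric] distrib_left case_prod_unfold)
  also have "(\<Sum>(u, v)\<in>edge_pairs G. (x u + x v) * z v) = (\<Sum>(u, v)\<in>edge_pairs G. (x u + x v) * z u)"
    by (subst sum_edge_pairs_swap) (simp add: add.commute)
  also have "(\<Sum>(u, v)\<in>edge_pairs G. (x u + x v) * z u)
      = (\<Sum>u\<in>verts G. \<Sum>v\<in>{v \<in> verts G. adjacent G u v}. (x u + x v) * z u)"
    unfolding edge_pairs_eq_Sigma using assms by (subst sum.Sigma) auto
  also have "\<dots> = (\<Sum>u\<in>verts G. z u * Q_apply G x u)"
    by (intro sum.cong refl)
      (simp add: Q_apply_def vdegree_def sum.distrib sum_distrib_right[symmetric] algebra_simps)
  finally show ?thesis by simp
qed

lemma pair_energy_edge_pairs_eq: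
  assumes "finite (verts G)"
  shows "pair_energy x (edge_pairs G) = 2 * (\<Sum>u\<in>verts G. x u * Q_apply G x u)"
  using polarized_energy_eq[OF assms, of x x] by (simp add: pair_energy_def power2_eq_square)

lemma pair_energy_eigen:
  assumes "finite (verts G)" "\<And>v. v \<in> verts G \<Longrightarrow> Q_apply G x v = k * x v"
  shows "pair_energy x (edge_pairs G) = 2 * k * (\<Sum>v\<in>verts G. (x v)\<^sup>2)"
  by (simp add: pair_energy_edge_pairs_eq assms sum_distrib_left power2_eq_square mult_ac)

lemma eigenvalue_Q_apply_iff:
  assumes "finite (verts G)"
  shows "eigenvalue (signless_laplacian G) k \<longleftrightarrow>
    (\<exists>x. (\<exists>v\<in>verts G. x v \<noteq> 0) \<and> (\<forall>v\<in>verts G. Q_apply G x v = k * x v))"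
  unfolding eigenvalue_signless_laplacian_iff[OF assms] Q_apply_def ..

section \<open>Rayleigh principle and Perron vector\<close>

lemma compact_sphere_functions:
  fixes V :: "'a set"
  assumes "finite V"
  shows "compact {x :: 'a \<Rightarrow> real. (\<forall>v. v \<notin> V \<longrightarrow> x v = 0) \<and> (\<Sum>v\<in>V. (x v)\<^sup>2) = 1}"
proof -
  \<comment> \<open>Vanishing outside \<open>V\<close> places the sphere in a product of compact
    factors, so Tychonoff's theorem applies even if the vertex type is infinite.\<close>
  define K where "K = PiE UNIV (\<lambda>v. if v \<in> V then {-1..1::real} else {0})"
  have "compactin (product_topology (\<lambda>_. euclidean) UNIV) K"
    unfolding K_def compactin_PiE by auto
  then have "compact K" by (simp add: euclidean_product_topology)
  moreover have "closed {x :: 'a \<Rightarrow> real. (\<Sum>v\<in>V. (x v)\<^sup>2) = 1}"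
    by (intro closed_Collect_eq continuous_intros continuous_on_product_coordinates)
  ultimately have "compact (K \<inter> {x. (\<Sum>v\<in>V. (x v)\<^sup>2) = 1})" by blast
  moreover have "\<bar>x v\<bar> \<le> 1" if "(\<Sum>v\<in>V. (x v)\<^sup>2) = 1" "v \<in> V" for x :: "'a \<Rightarrow> real" and v
  proof -
    have "(x v)\<^sup>2 \<le> 1"
      using member_le_sum[of v V "\<lambda>v. (x v)\<^sup>2"] that assms by simp
    then show ?thesis by (simp add: abs_square_le_1)
  qed
  then have "K \<inter> {x. (\<Sum>v\<in>V. (x v)\<^sup>2) = 1} = {x. (\<forall>v. v \<notin> V \<longrightarrow> x v = 0) \<and> (\<Sum>v\<in>V. (x v)\<^sup>2) = 1}"
    by (fastforce simp: K_def PiE_def Pi_def abs_le_iff split: if_splits)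
  ultimately show ?thesis by simp
qed

text \<open>Compactness gives a maximizer on the unit sphere, absolute values make it nonnegative,
  and homogeneity of degree 2 carries the bound to every \<open>x\<close>.\<close>

lemma pair_energy_maximizer:
  assumes fin: "finite (verts G)" and ne: "verts G \<noteq> {}"
  obtains y where "\<And>v. y v \<ge> 0" "(\<Sum>v\<in>verts G. (y v)\<^sup>2) = 1"
    "\<And>x. pair_energy x (edge_pairs G) \<le> pair_energy y (edge_pairs G) * (\<Sum>v\<in>verts G. (x v)\<^sup>2)"
proof -
  define V where "V = verts G"
  define F where "F x = pair_energy x (edge_pairs G)" for x
  define S where "S = {x :: 'a \<Rightarrow> real. (\<forall>v. v \<notin> V \<longrightarrow> x v = 0) \<and> (\<Sum>v\<in>V. (x v)\<^sup>2) = 1}"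
  obtain w where w: "w \<in> V" using ne by (auto simp: V_def)
  have finV: "finite V" using fin by (simp add: V_def)
  have "(\<Sum>v\<in>V. (if v = w then 1 else 0 :: real)\<^sup>2) = (\<Sum>v\<in>V. if v = w then 1 else 0)"
    by (intro sum.cong) auto
  then have "(\<lambda>v. if v = w then 1 else 0) \<in> S"
    using w finV by (auto simp: S_def)
  moreover have "compact S" unfolding S_def by (rule compact_sphere_functions[OF finV])
  moreover have "continuous_on S F"
    unfolding F_def pair_energy_def case_prod_unfold
    by (intro continuous_intros continuous_on_subset[OF continuous_on_product_coordinates]) auto
  ultimately obtain z where z: "z \<in> S" "\<And>x. x \<in> S \<Longrightarrow> F x \<le> F z"
    using continuous_attains_sup[of S F] by blast
  define y where "y v = \<bar>z v\<bar>" for v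
  \<comment> \<open>By the triangle inequality, absolute values cannot lower the energy.\<close>
  have "F z \<le> F y"
    unfolding F_def pair_energy_def y_def
    by (intro sum_mono) (auto intro!: abs_le_square_iff[THEN iffD1])
  moreover have "y \<in> S" using z(1) by (auto simp: S_def y_def)
  ultimately have Fy: "F x \<le> F y" if "x \<in> S" for x using z(2)[OF that] by simp
  have "F x \<le> F y * (\<Sum>v\<in>V. (x v)\<^sup>2)" for x
  proof -
    define s where "s = (\<Sum>v\<in>V. (x v)\<^sup>2)"
    \<comment> \<open>Membership in \<open>S\<close> demands the cut-off outside \<open>V\<close>;
      the energy ignores it because edge pairs lie in \<open>V\<close>.\<close>
    have F_scale: "F (\<lambda>v. if v \<in> V then c * x v else 0) = c\<^sup>2 * F x" for c
      unfolding F_def pair_energy_def sum_distrib_left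
      by (intro sum.cong) (auto simp: edge_pairs_def V_def power_mult_distrib[symmetric] distrib_left)
    show ?thesis
    proof (cases "s = 0")
      case True
      then have x0: "\<forall>v\<in>V. x v = 0" using finV by (simp add: s_def sum_nonneg_eq_0_iff)
      have "F x = 0"
        unfolding F_def pair_energy_def
        by (rule sum.neutral) (use x0 in \<open>auto simp: edge_pairs_def V_def\<close>)
      with True show ?thesis by (simp add: s_def)
    next
      case False
      then have s: "s > 0" by (simp add: s_def sum_nonneg order.strict_iff_order)
      define c where "c = 1 / sqrt s"
      have c2: "c\<^sup>2 = 1 / s" using s by (simp add: c_def power_divide)
      have "(\<lambda>v. if v \<in> V then c * x v else 0) \<in> S"
        using s c2 unfolding S_def by (simp add: power_mult_distrib sum_divide_distrib[symmetric] s_def[symmetric])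
      then have "c\<^sup>2 * F x \<le> F y" using Fy F_scale by metis
      then show ?thesis using s c2 by (simp add: s_def[symmetric] field_simps)
    qed
  qed
  with \<open>y \<in> S\<close> show thesis by (intro that[of y]) (auto simp: y_def S_def V_def F_def)
qed

text \<open>First-order condition at the maximum \<open>t = 0\<close>: for small \<open>t\<close> a
  nonzero linear term outweighs the quadratic one.\<close>

lemma linear_coeff_zero:
  fixes a b :: real
  assumes "\<And>t. t * a + t\<^sup>2 * b \<le> 0"
  shows "a = 0"
proof (rule ccontr)
  assume "a \<noteq> 0"
  \<comment> \<open>\<open>d\<close> exceeds \<open>- b\<close>, which makes the value at
    \<open>t = a / d\<close> positive.\<close>
  define d where "d = 1 + \<bar>b\<bar>"
  have d: "d > 0" "b + d > 0" by (auto simp: d_def)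
  have "a / d * a + (a / d)\<^sup>2 * b = a\<^sup>2 * (d + b) / d\<^sup>2"
    using d by (simp add: field_simps power2_eq_square)
  moreover have "a\<^sup>2 * (d + b) / d\<^sup>2 > 0" using d \<open>a \<noteq> 0\<close> by simp
  ultimately show False using assms[of "a / d"] by linarith
qed

text \<open>Varying a maximizer one coordinate at a time shows that it is an eigenvector. The
  Rayleigh quotient of any other eigenvector is at most the maximum, so its eigenvalue is the
  largest.\<close>

lemma Q_index_variational:
  assumes fin: "finite (verts G)" and ne: "verts G \<noteq> {}"
  obtains y where "\<And>v. y v \<ge> 0" "(\<Sum>v\<in>verts G. (y v)\<^sup>2) = 1"
    "\<And>v. v \<in> verts G \<Longrightarrow> Q_apply G y v = Q_index G * y v"
    "\<And>x. pair_energy x (edge_pairs G) \<le> 2 * Q_index G * (\<Sum>v\<in>verts G. (x v)\<^sup>2)"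
proof -
  define F where "F x = pair_energy x (edge_pairs G)" for x
  define N where "N x = (\<Sum>v\<in>verts G. (x v)\<^sup>2)" for x :: "'a \<Rightarrow> real"
  obtain y where y: "\<And>v. y v \<ge> 0" "N y = 1" "\<And>x. F x \<le> F y * N x"
    using pair_energy_maximizer[OF fin ne] unfolding F_def N_def by metis
  define k where "k = F y / 2"
  have eig: "Q_apply G y w = k * y w" if w: "w \<in> verts G" for w
  proof -
    define e where "e v = (if v = w then 1 else 0 :: real)" for v
    define D where "D = F e"
    have F_exp: "F (\<lambda>v. y v + t * e v) = F y + 4 * t * Q_apply G y w + t\<^sup>2 * D" for t
    proof -
      have "F (\<lambda>v. y v + t * e v) = F y
          + 2 * t * (\<Sum>(u, v)\<in>edge_pairs G. (y u + y v) * (e u + e v)) + t\<^sup>2 * D"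
        unfolding F_def D_def pair_energy_def sum_distrib_left sum.distrib[symmetric]
        by (intro sum.cong) (auto simp: power2_eq_square algebra_simps)
      also have "(\<Sum>(u, v)\<in>edge_pairs G. (y u + y v) * (e u + e v)) = 2 * Q_apply G y w"
        using w fin by (simp add: polarized_energy_eq e_def if_distrib[of "\<lambda>c. c * _"] cong: if_cong)
      finally show ?thesis by simp
    qed
    have N_exp: "N (\<lambda>v. y v + t * e v) = 1 + 2 * t * y w + t\<^sup>2" for t
    proof -
      have "N (\<lambda>v. y v + t * e v) = N y + (\<Sum>v\<in>verts G. if v = w then 2 * t * y w + t\<^sup>2 else 0)"
        unfolding N_def sum.distrib[symmetric]
        by (intro sum.cong) (auto simp: e_def power2_eq_square algebra_simps)
      then show ?thesis using w fin y(2) by simp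
    qed
    \<comment> \<open>Maximality along the line through \<open>y\<close> in direction
      \<open>e\<close>, after the constant terms cancel and with \<open>F y = 2 * k\<close>.\<close>
    have "t * (4 * (Q_apply G y w - k * y w)) + t\<^sup>2 * (D - 2 * k) \<le> 0" for t
      using y(3)[of "\<lambda>v. y v + t * e v"] unfolding F_exp N_exp k_def
      by (simp add: algebra_simps)
    from linear_coeff_zero[OF this] show ?thesis by simp
  qed
  have "Q_index G = k"
    unfolding Q_index_def
  proof (rule Max_eqI[OF finite_eigenvalues_signless_laplacian])
    have "\<exists>v\<in>verts G. y v \<noteq> 0"
    proof (rule ccontr)
      assume "\<not> ?thesis"
      then have "N y = 0" by (simp add: N_def)
      with y(2) show False by simp
    qed
    then show "k \<in> {k. eigenvalue (signless_laplacian G) k}"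
      using eig eigenvalue_Q_apply_iff[OF fin] by blast
  next
    fix m assume "m \<in> {k. eigenvalue (signless_laplacian G) k}"
    then obtain x v where x: "v \<in> verts G" "x v \<noteq> 0" "\<And>v. v \<in> verts G \<Longrightarrow> Q_apply G x v = m * x v"
      using eigenvalue_Q_apply_iff[OF fin] by blast
    have "F x = 2 * m * N x"
      unfolding F_def N_def by (rule pair_energy_eigen[OF fin x(3)])
    then have "m * N x \<le> k * N x" using y(3)[of x] by (simp add: k_def)
    moreover have "N x > 0"
      unfolding N_def using fin x by (intro sum_pos2[of _ v]) auto
    ultimately show "m \<le> k" by simp
  qed
  moreover have "F x \<le> 2 * k * N x" for x using y(3)[of x] by (simp add: k_def)
  ultimately show thesis using y eig by (intro that[of y]) (auto simp: F_def N_def)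
qed

lemma pair_energy_le_Q_index:
  assumes "finite (verts G)" "verts G \<noteq> {}"
  shows "pair_energy x (edge_pairs G) \<le> 2 * Q_index G * (\<Sum>v\<in>verts G. (x v)\<^sup>2)"
  using Q_index_variational[OF assms] by metis

text \<open>At a zero of the nonnegative eigenvector the eigenvalue equation makes the sum over the
  neighbours vanish, hence every term of it; connectedness spreads this to all vertices, against
  norm 1.\<close>

lemma Q_index_Perron_vector:
  assumes G: "simple_graph G" and con: "connected_graph G"
  obtains x where "\<And>v. v \<in> verts G \<Longrightarrow> x v > 0"
    "pair_energy x (edge_pairs G) = 2 * Q_index G * (\<Sum>v\<in>verts G. (x v)\<^sup>2)"
proof -
  have fin: "finite (verts G)" using G by (simp add: simple_graph_def)
  have ne: "verts G \<noteq> {}" using con by (simp add: connected_graph_def)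
  obtain y where y: "\<And>v. y v \<ge> 0" "(\<Sum>v\<in>verts G. (y v)\<^sup>2) = 1"
    "\<And>v. v \<in> verts G \<Longrightarrow> Q_apply G y v = Q_index G * y v"
    using Q_index_variational[OF fin ne] by metis
  have step: "y u = 0" if "v \<in> verts G" "y v = 0" "adjacent G v u" for u v
  proof -
    have "(\<Sum>u\<in>{u \<in> verts G. adjacent G v u}. y u) = 0"
      using y(3)[OF that(1)] that(2) by (simp add: Q_apply_def)
    then show ?thesis
      using fin y(1) that simple_graph_adjacentD[OF G that(3)]
      by (subst (asm) sum_nonneg_eq_0_iff) auto
  qed
  have spread: "y u = 0" if "reachable G v u" "v \<in> verts G" "y v = 0" for u v
  proof -
    have "(adjacent G)\<^sup>*\<^sup>* v u" using that(1) by (simp add: reachable_def)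
    then have "u \<in> verts G \<and> y u = 0"
      by induction (use that step simple_graph_adjacentD[OF G] in blast)+
    then show ?thesis ..
  qed
  have "y v > 0" if v: "v \<in> verts G" for v
  proof (rule ccontr)
    assume "\<not> y v > 0"
    then have "y v = 0" using y(1)[of v] by linarith
    then have "\<forall>u\<in>verts G. y u = 0"
      using spread v con by (auto simp: connected_graph_def)
    with y(2) show False by simp
  qed
  then show thesis using that pair_energy_eigen[OF fin y(3)] by blast
qed

section \<open>Comparison with the extremal graph\<close>

lemma finite_cross:
  assumes "finite V" "X \<subseteq> V" "Y \<subseteq> V"
  shows "finite (X \<times> Y)"
  using assms by (auto intro: finite_subset)

text \<open>For disjoint subsets \<open>X\<close>, \<open>Y\<close> of \<open>V\<close> these are
  the edge pairs of the join of a clique on \<open>V - X - Y\<close> with the disjoint union of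
  cliques on \<open>X\<close> and \<open>Y\<close>.\<close>

definition cross_free_pairs :: "'a set \<Rightarrow> 'a set \<Rightarrow> 'a set \<Rightarrow> ('a \<times> 'a) set" where
  "cross_free_pairs V X Y = {(u, v). u \<in> V \<and> v \<in> V \<and> u \<noteq> v} - X \<times> Y - Y \<times> X"

text \<open>The first term does not depend on \<open>X\<close> and \<open>Y\<close>, so comparing
  two separations amounts to comparing their cross energies.\<close>

lemma pair_energy_cross_free_pairs:
  assumes "finite V" "X \<subseteq> V" "Y \<subseteq> V" "X \<inter> Y = {}"
  shows "pair_energy x (cross_free_pairs V X Y)
    = pair_energy x {(u, v). u \<in> V \<and> v \<in> V \<and> u \<noteq> v} - 2 * pair_energy x (X \<times> Y)"
proof -
  define K where "K = {(u, v). u \<in> V \<and> v \<in> V \<and> u \<noteq> v}"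
  have "finite K" by (rule finite_subset[of _ "V \<times> V"]) (use assms in \<open>auto simp: K_def\<close>)
  moreover have "X \<times> Y \<subseteq> K" "Y \<times> X \<subseteq> K - X \<times> Y" using assms by (auto simp: K_def)
  moreover have "finite (X \<times> Y)" "finite (Y \<times> X)" using assms finite_cross by metis+
  moreover have "pair_energy x (Y \<times> X) = pair_energy x (X \<times> Y)"
    unfolding pair_energy_def
    by (rule sum.reindex_bij_witness[of _ "\<lambda>(u, v). (v, u)" "\<lambda>(u, v). (v, u)"])
      (auto simp: add.commute)
  ultimately show ?thesis
    unfolding cross_free_pairs_def K_def[symmetric] by (simp add: pair_energy_def sum_diff)
qed

section \<open>Recognizing copies of the extremal graph\<close>

lemma adjacent_complete_graph: "adjacent (complete_graph r) i j \<longleftrightarrow> i < r \<and> j < r \<and> i \<noteq> j"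
  by (auto simp: adjacent_def complete_graph_def card_2_iff doubleton_eq_iff)

lemma adjacent_disjoint_union:
  fixes G :: "'a sgraph" and H :: "'b sgraph"
  shows "adjacent (disjoint_union G H) (Inl u) (Inl v) \<longleftrightarrow> adjacent G u v"
    "adjacent (disjoint_union G H) (Inr a) (Inr b) \<longleftrightarrow> adjacent H a b"
    "\<not> adjacent (disjoint_union G H) (Inl u) (Inr b)"
    "\<not> adjacent (disjoint_union G H) (Inr b) (Inl u)"
proof -
  have "{Inl u, Inl v :: 'a + 'b} = Inl ` e \<longleftrightarrow> {u, v} = e" for e
    using inj_image_eq_iff[OF inj_Inl, of "{u, v}" e] by simp
  moreover have "{Inr a, Inr b :: 'a + 'b} = Inr ` d \<longleftrightarrow> {a, b} = d" for d
    using inj_image_eq_iff[OF inj_Inr, of "{a, b}" d] by simp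
  moreover have "{Inl u, Inl v :: 'a + 'b} \<noteq> Inr ` d" "{Inr a, Inr b :: 'a + 'b} \<noteq> Inl ` e" for d e
    by blast+
  ultimately show "adjacent (disjoint_union G H) (Inl u) (Inl v) \<longleftrightarrow> adjacent G u v"
    "adjacent (disjoint_union G H) (Inr a) (Inr b) \<longleftrightarrow> adjacent H a b"
    by (auto simp: adjacent_def disjoint_union_def image_iff)
qed (auto simp: adjacent_def disjoint_union_def)

lemma adjacent_graph_join:
  "adjacent (graph_join G H) (Inl u) (Inl v) \<longleftrightarrow> adjacent G u v"
  "adjacent (graph_join G H) (Inr a) (Inr b) \<longleftrightarrow> adjacent H a b"
  "adjacent (graph_join G H) (Inl u) (Inr b) \<longleftrightarrow> u \<in> verts G \<and> b \<in> verts H"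
  "adjacent (graph_join G H) (Inr b) (Inl u) \<longleftrightarrow> u \<in> verts G \<and> b \<in> verts H"
proof -
  have "adjacent (graph_join G H) p q \<longleftrightarrow> adjacent (disjoint_union G H) p q
    \<or> (\<exists>u\<in>verts G. \<exists>v\<in>verts H. {p, q} = {Inl u, Inr v})" for p q
    by (simp only: adjacent_def graph_join_def disjoint_union_def sgraph.simps Un_iff mem_Collect_eq) blast
  then show "adjacent (graph_join G H) (Inl u) (Inl v) \<longleftrightarrow> adjacent G u v"
    "adjacent (graph_join G H) (Inr a) (Inr b) \<longleftrightarrow> adjacent H a b"
    "adjacent (graph_join G H) (Inl u) (Inr b) \<longleftrightarrow> u \<in> verts G \<and> b \<in> verts H"
    "adjacent (graph_join G H) (Inr b) (Inl u) \<longleftrightarrow> u \<in> verts G \<and> b \<in> verts H"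
    by (auto simp: adjacent_disjoint_union doubleton_eq_iff)
qed

text \<open>The graph defining \<open>q\<^sub>2\<close>, with \<open>d\<close> for \<delta> and
  \<open>m\<close> for the order of the large clique next to \<open>K_2\<close>.\<close>

definition extremal_graph :: "nat \<Rightarrow> nat \<Rightarrow> (nat + nat + nat) sgraph" where
  "extremal_graph d m = graph_join (complete_graph d) (disjoint_union (complete_graph 2) (complete_graph m))"

lemma verts_extremal_graph: "verts (extremal_graph d m) = {..<d} <+> {..<2} <+> {..<m}"
  by (simp add: extremal_graph_def graph_join_def disjoint_union_def complete_graph_def)

text \<open>Since \<open>U\<close> has two elements, the pairs on the left form a copy of the
  extremal graph; \<open>x\<close> is transported along a bijection and the Rayleigh bound applied
  there.\<close>

lemma cross_free_energy_le_extremal: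
  assumes V: "finite V" and CU: "C \<subseteq> V" "U \<subseteq> V" "C \<inter> U = {}" and card: "card C = d" "card U = 2"
  shows "pair_energy x (cross_free_pairs V U (V - C - U))
    \<le> 2 * Q_index (extremal_graph d (card V - d - 2)) * (\<Sum>v\<in>V. (x v)\<^sup>2)"
proof -
  define R where "R = V - C - U"
  define m where "m = card V - d - 2"
  define T where "T = extremal_graph d m"
  have fin: "finite C" "finite U" "finite R" using V CU by (auto simp: R_def intro: finite_subset)
  have "card R = card V - card C - card U"
    unfolding R_def using CU fin by (subst card_Diff_subset; (subst card_Diff_subset)?) auto
  then have "card R = m" by (simp add: m_def card)
  then obtain h where h: "bij_betw h R {..<m}"
    using finite_same_card_bij[OF fin(3), of "{..<m}"] by auto
  obtain f where f: "bij_betw f C {..<d}"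
    using finite_same_card_bij[OF fin(1), of "{..<d}"] card by auto
  obtain g where g: "bij_betw g U {..<2::nat}"
    using finite_same_card_bij[OF fin(2), of "{..<2::nat}"] card by auto
  define \<phi> where "\<phi> v = (if v \<in> C then Inl (f v) else if v \<in> U then Inr (Inl (g v)) else Inr (Inr (h v)))"
    for v :: 'a
  have V_split: "V = C \<union> (U \<union> R)" using CU by (auto simp: R_def)
  have phi: "bij_betw \<phi> V (verts T)"
  proof -
    have "bij_betw (\<lambda>v. Inl (f v)) C (Inl ` {..<d})"
      using bij_betw_trans[OF f, of "Inl" "Inl ` {..<d}"]
      by (simp add: comp_def bij_betw_def inj_on_def image_image)
    then have "bij_betw \<phi> C (Inl ` {..<d})"
      by (rule bij_betw_cong[THEN iffD1, rotated]) (simp add: \<phi>_def)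
    moreover have "bij_betw (\<lambda>v. Inr (Inl (g v))) U (Inr ` Inl ` {..<2})"
      using bij_betw_trans[OF g, of "\<lambda>i. Inr (Inl i)" "Inr ` Inl ` {..<2}"]
      by (simp add: comp_def bij_betw_def inj_on_def image_image)
    then have "bij_betw \<phi> U (Inr ` Inl ` {..<2})"
      by (rule bij_betw_cong[THEN iffD1, rotated]) (use CU in \<open>auto simp: \<phi>_def\<close>)
    moreover have "bij_betw (\<lambda>v. Inr (Inr (h v))) R (Inr ` Inr ` {..<m})"
      using bij_betw_trans[OF h, of "\<lambda>i. Inr (Inr i)" "Inr ` Inr ` {..<m}"]
      by (simp add: comp_def bij_betw_def inj_on_def image_image)
    then have "bij_betw \<phi> R (Inr ` Inr ` {..<m})"
      by (rule bij_betw_cong[THEN iffD1, rotated]) (auto simp: \<phi>_def R_def)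
    ultimately have "bij_betw \<phi> (C \<union> (U \<union> R)) (Inl ` {..<d} \<union> (Inr ` Inl ` {..<2} \<union> Inr ` Inr ` {..<m}))"
      by (intro bij_betw_combine) auto
    then show ?thesis
      by (simp add: V_split T_def verts_extremal_graph Plus_def image_Un)
  qed
  have inj: "\<phi> u = \<phi> v \<longleftrightarrow> u = v" if "u \<in> V" "v \<in> V" for u v
    using phi that by (auto simp: bij_betw_def inj_on_def)
  have adj: "adjacent T (\<phi> u) (\<phi> v) \<longleftrightarrow> (u, v) \<in> cross_free_pairs V U R" if "u \<in> V" "v \<in> V" for u v
  proof -
    \<comment> \<open>Block and image of a vertex; adjacency is then checked for every combination
      of two blocks.\<close>
    have cases: "w \<in> C \<and> w \<notin> U \<and> w \<notin> R \<and> \<phi> w = Inl (f w) \<and> f w < d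
      \<or> w \<notin> C \<and> w \<in> U \<and> w \<notin> R \<and> \<phi> w = Inr (Inl (g w)) \<and> g w < 2
      \<or> w \<notin> C \<and> w \<notin> U \<and> w \<in> R \<and> \<phi> w = Inr (Inr (h w)) \<and> h w < m" if "w \<in> V" for w
      using that CU f g h by (auto simp: \<phi>_def R_def bij_betw_def)
    show ?thesis
      using cases[OF that(1)] cases[OF that(2)] inj[OF that] that
      by (auto simp: T_def extremal_graph_def adjacent_graph_join adjacent_disjoint_union
          adjacent_complete_graph cross_free_pairs_def)
        (auto simp: complete_graph_def disjoint_union_def)
  qed
  have pairs: "bij_betw (map_prod \<phi> \<phi>) (cross_free_pairs V U R) (edge_pairs T)"
  proof -
    have "inj_on (map_prod \<phi> \<phi>) (cross_free_pairs V U R)"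
      using inj by (auto simp: inj_on_def cross_free_pairs_def)
    moreover have "map_prod \<phi> \<phi> ` cross_free_pairs V U R = edge_pairs T"
    proof (intro equalityI subsetI)
      fix p assume "p \<in> map_prod \<phi> \<phi> ` cross_free_pairs V U R"
      then show "p \<in> edge_pairs T"
        using adj phi by (auto simp: edge_pairs_def cross_free_pairs_def bij_betw_def)
    next
      fix p assume "p \<in> edge_pairs T"
      then obtain s t where st: "p = (s, t)" "s \<in> \<phi> ` V" "t \<in> \<phi> ` V" "adjacent T s t"
        using bij_betw_imp_surj_on[OF phi] by (auto simp: edge_pairs_def)
      then obtain u v where "u \<in> V" "v \<in> V" "p = (\<phi> u, \<phi> v)" "adjacent T (\<phi> u) (\<phi> v)"
        by blast
      then show "p \<in> map_prod \<phi> \<phi> ` cross_free_pairs V U R"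
        using adj by (force simp: image_iff)
    qed
    ultimately show ?thesis by (simp add: bij_betw_def)
  qed
  define z where "z = x \<circ> the_inv_into V \<phi>"
  have z: "z (\<phi> v) = x v" if "v \<in> V" for v
    using phi that by (simp add: z_def the_inv_into_f_f bij_betw_def)
  have "pair_energy x (cross_free_pairs V U R) = pair_energy z (edge_pairs T)"
    unfolding pair_energy_def sum.reindex_bij_betw[OF pairs, symmetric]
    by (rule sum.cong) (auto simp: cross_free_pairs_def z)
  also have "\<dots> \<le> 2 * Q_index T * (\<Sum>v\<in>verts T. (z v)\<^sup>2)"
    by (rule pair_energy_le_Q_index) (auto simp: T_def verts_extremal_graph Plus_def lessThan_empty_iff)
  also have "(\<Sum>v\<in>verts T. (z v)\<^sup>2) = (\<Sum>v\<in>V. (x v)\<^sup>2)"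
    unfolding sum.reindex_bij_betw[OF phi, symmetric] by (rule sum.cong) (auto simp: z)
  finally show ?thesis by (simp add: T_def m_def R_def)
qed

section \<open>Separating two vertices instead of the given parts\<close>

lemma obtain_three:
  assumes "card A \<ge> 3"
  obtains a b c where "{a, b, c} \<subseteq> A" "a \<noteq> b" "a \<noteq> c" "b \<noteq> c"
proof -
  obtain S where "S \<subseteq> A" "card S = 3" using obtain_subset_with_card_n[OF assms] by metis
  then show thesis using that by (auto simp: card_3_iff)
qed

text \<open>The sizes that the exchange argument can treat: a part of two vertices is itself the
  pair sought, and otherwise both parts must supply three vertices for a pigeonhole
  argument.\<close>

definition split_sizes :: "'a set \<Rightarrow> 'a set \<Rightarrow> bool" where
  "split_sizes A B \<longleftrightarrow> card A = 2 \<or> card B = 2 \<or> card A \<ge> 3 \<and> card B \<ge> 3"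

lemma pair_energy_Times:
  "pair_energy x (X \<times> Y) = (\<Sum>a\<in>X. \<Sum>b\<in>Y. (x a + x b)\<^sup>2)"
  by (simp add: pair_energy_def sum.cartesian_product)

lemma pair_energy_Times_commute: "pair_energy x (X \<times> Y) = pair_energy x (Y \<times> X)"
  unfolding pair_energy_Times by (subst sum.swap) (simp add: add.commute)

text \<open>The cross pairs between \<open>{u, v}\<close> and \<open>B\<close> occur on both sides.
  The new ones, from \<open>{u, v}\<close> to a remaining \<open>a\<close> in \<open>A\<close>, are
  paid for by the pairs from \<open>a\<close> to \<open>p\<close> and \<open>q\<close>, where
  \<open>x\<close> is at least as large.\<close>

lemma pair_separation_le_dominated:
  assumes fin: "finite A" "finite B" and disj: "A \<inter> B = {}"
    and x: "\<And>v. v \<in> A \<union> B \<Longrightarrow> x v \<ge> 0"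
    and uv: "u \<in> A" "v \<in> A" "u \<noteq> v" and pq: "p \<in> B" "q \<in> B" "p \<noteq> q"
    and le: "x u \<le> x p" "x v \<le> x q"
  shows "pair_energy x ({u, v} \<times> (A \<union> B - {u, v})) \<le> pair_energy x (A \<times> B)"
proof -
  define U where "U = {u, v}"
  define f where "f a b = (x a + x b)\<^sup>2" for a b
  have UA: "U \<subseteq> A" "finite U" using uv by (auto simp: U_def)
  have "A \<union> B - U = (A - U) \<union> B" using UA disj by auto
  then have "pair_energy x (U \<times> (A \<union> B - U)) = (\<Sum>a\<in>U. \<Sum>b\<in>(A - U) \<union> B. f a b)"
    by (simp add: pair_energy_Times f_def)
  also have "\<dots> = (\<Sum>a\<in>U. \<Sum>b\<in>A - U. f a b) + (\<Sum>a\<in>U. \<Sum>b\<in>B. f a b)"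
    using fin disj by (subst sum.union_disjoint) (auto simp: sum.distrib)
  also have "(\<Sum>a\<in>U. \<Sum>b\<in>A - U. f a b) = (\<Sum>b\<in>A - U. \<Sum>a\<in>U. f a b)"
    by (rule sum.swap)
  also have "\<dots> \<le> (\<Sum>a\<in>A - U. \<Sum>b\<in>B. f a b)"
  proof (rule sum_mono)
    fix a assume a: "a \<in> A - U"
    have "(\<Sum>t\<in>U. f t a) = f u a + f v a" using uv by (simp add: U_def)
    also have "\<dots> \<le> f a p + f a q"
    proof (rule add_mono)
      have "x u \<ge> 0" "x v \<ge> 0" "x a \<ge> 0" using a uv x by auto
      then show "f u a \<le> f a p" "f v a \<le> f a q"
        unfolding f_def using le by (auto intro!: power_mono)
    qed
    also have "\<dots> = (\<Sum>b\<in>{p, q}. f a b)" using pq by simp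
    also have "\<dots> \<le> (\<Sum>b\<in>B. f a b)"
      by (rule sum_mono2) (use fin pq in \<open>auto simp: f_def\<close>)
    finally show "(\<Sum>t\<in>U. f t a) \<le> (\<Sum>b\<in>B. f a b)" .
  qed
  also have "(\<Sum>a\<in>A - U. \<Sum>b\<in>B. f a b) + (\<Sum>a\<in>U. \<Sum>b\<in>B. f a b) = pair_energy x (A \<times> B)"
    using sum.subset_diff[OF UA(1) fin(1), of "\<lambda>a. \<Sum>b\<in>B. f a b"] by (simp add: pair_energy_Times f_def)
  finally show ?thesis by (simp add: U_def)
qed

lemma obtain_pair_separation:
  assumes fin: "finite A" "finite B" and disj: "A \<inter> B = {}"
    and x: "\<And>v. v \<in> A \<union> B \<Longrightarrow> x v \<ge> 0" and sizes: "split_sizes A B"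
  obtains U where "U \<subseteq> A \<union> B" "card U = 2" "pair_energy x (U \<times> (A \<union> B - U)) \<le> pair_energy x (A \<times> B)"
proof -
  note dom = pair_separation_le_dominated[where x = x]
  consider "card A = 2" | "card B = 2" | "card A \<ge> 3" "card B \<ge> 3"
    using sizes by (auto simp: split_sizes_def)
  then show thesis
  proof cases
    case 1
    moreover have "A \<union> B - A = B" using disj by auto
    ultimately show thesis using that[of A] by simp
  next
    case 2
    moreover have "A \<union> B - B = A" using disj by auto
    ultimately show thesis using that[of B] by (simp add: pair_energy_Times_commute)
  next
    case 3
    obtain a b c where abc: "{a, b, c} \<subseteq> A" "a \<noteq> b" "a \<noteq> c" "b \<noteq> c"
      using obtain_three[OF 3(1)] .
    obtain p q r where pqr: "{p, q, r} \<subseteq> B" "p \<noteq> q" "p \<noteq> r" "q \<noteq> r"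
      using obtain_three[OF 3(2)] .
    have A_side: thesis if "u \<in> A" "v \<in> A" "u \<noteq> v" "s \<in> B" "t \<in> B" "s \<noteq> t" "x u \<le> x s" "x v \<le> x t" for u v s t
      using that \<open>\<And>U. \<lbrakk>U \<subseteq> A \<union> B; card U = 2; _\<rbrakk> \<Longrightarrow> thesis\<close>[of "{u, v}"] dom[OF fin disj x that] by auto
    have B_side: thesis if "u \<in> B" "v \<in> B" "u \<noteq> v" "s \<in> A" "t \<in> A" "s \<noteq> t" "x u \<le> x s" "x v \<le> x t" for u v s t
      using that \<open>\<And>U. \<lbrakk>U \<subseteq> A \<union> B; card U = 2; _\<rbrakk> \<Longrightarrow> thesis\<close>[of "{u, v}"] dom[OF fin(2,1) _ _ that] disj x
      by (auto simp: Un_commute Int_commute pair_energy_Times_commute)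
    \<comment> \<open>Pigeonhole: of the comparisons \<open>a\<close> with \<open>p\<close>,
      \<open>b\<close> with \<open>q\<close>, \<open>c\<close> with \<open>r\<close>, two have the
      same direction.\<close>
    consider "x a \<le> x p \<and> x b \<le> x q" | "x a \<le> x p \<and> x c \<le> x r" | "x b \<le> x q \<and> x c \<le> x r"
      | "x p \<le> x a \<and> x q \<le> x b" | "x p \<le> x a \<and> x r \<le> x c" | "x q \<le> x b \<and> x r \<le> x c"
      by linarith
    then show thesis
    proof cases
      case 1
      show thesis by (rule A_side[of a b p q]) (use 1 abc pqr in auto)
    next
      case 2
      show thesis by (rule A_side[of a c p r]) (use 2 abc pqr in auto)
    next
      case 3
      show thesis by (rule A_side[of b c q r]) (use 3 abc pqr in auto)
    next
      case 4
      show thesis by (rule B_side[of p q a b]) (use 4 abc pqr in auto)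
    next
      case 5
      show thesis by (rule B_side[of p r a c]) (use 5 abc pqr in auto)
    next
      case 6
      show thesis by (rule B_side[of q r b c]) (use 6 abc pqr in auto)
    qed
  qed
qed

text \<open>Filling in all pairs except those between \<open>A\<close> and \<open>B\<close> strictly
  raises the energy of the Perron vector, as its entries at the missing pair are positive.
  Separating a suitable \<open>U\<close> instead keeps the gain and reaches the extremal
  graph.\<close>

theorem Q_index_less_extremal:
  assumes G: "simple_graph G" "connected_graph G"
    and split: "C \<union> A \<union> B = verts G" "C \<inter> A = {}" "C \<inter> B = {}" "A \<inter> B = {}"
    and sizes: "split_sizes A B"
    and no_edge: "\<And>a b. a \<in> A \<Longrightarrow> b \<in> B \<Longrightarrow> \<not> adjacent G a b"
    and missing: "(u, v) \<in> cross_free_pairs (verts G) A B" "\<not> adjacent G u v"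
  shows "Q_index G < Q_index (extremal_graph (card C) (card (verts G) - card C - 2))"
proof -
  define V where "V = verts G"
  have fin: "finite V" using G by (simp add: V_def simple_graph_def)
  then have finAB: "finite A" "finite B" using split by (auto simp: V_def intro: finite_subset)
  obtain x where x: "\<And>v. v \<in> V \<Longrightarrow> x v > 0"
    "pair_energy x (edge_pairs G) = 2 * Q_index G * (\<Sum>v\<in>V. (x v)\<^sup>2)"
    using Q_index_Perron_vector[OF G] unfolding V_def by metis
  have "x v \<ge> 0" if "v \<in> A \<union> B" for v using x(1)[of v] that split by (force simp: V_def)
  then obtain U where U: "U \<subseteq> A \<union> B" "card U = 2"
    "pair_energy x (U \<times> (A \<union> B - U)) \<le> pair_energy x (A \<times> B)"
    using obtain_pair_separation[OF finAB split(4) _ sizes, of x] by metis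
  have rest: "A \<union> B - U = V - C - U" using split by (auto simp: V_def)
  have "edge_pairs G \<subseteq> cross_free_pairs V A B"
    using no_edge simple_graph_adjacentD(3)[OF G(1)] adjacent_commute[of G]
    unfolding edge_pairs_def cross_free_pairs_def V_def by blast
  moreover have "finite (cross_free_pairs V A B)"
    by (rule finite_subset[of _ "V \<times> V"]) (use fin in \<open>auto simp: cross_free_pairs_def\<close>)
  moreover have "(u, v) \<in> cross_free_pairs V A B - edge_pairs G"
    using missing by (simp add: V_def edge_pairs_def)
  moreover have "x u > 0" "x v > 0" using missing x by (auto simp: V_def cross_free_pairs_def)
  ultimately have "pair_energy x (edge_pairs G) < pair_energy x (cross_free_pairs V A B)"
    unfolding pair_energy_def by (intro sum_strict_mono2[of _ _ "(u, v)"]) auto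
  \<comment> \<open>Less energy across the new separation means more energy in the pairs that are
    kept.\<close>
  also have "\<dots> \<le> pair_energy x (cross_free_pairs V U (A \<union> B - U))"
    using U fin split by (subst (1 2) pair_energy_cross_free_pairs) (auto simp: V_def)
  also have "\<dots> \<le> 2 * Q_index (extremal_graph (card C) (card V - card C - 2)) * (\<Sum>v\<in>V. (x v)\<^sup>2)"
    unfolding rest using U split by (intro cross_free_energy_le_extremal fin) (auto simp: V_def)
  finally have "Q_index G * (\<Sum>v\<in>V. (x v)\<^sup>2)
      < Q_index (extremal_graph (card C) (card V - card C - 2)) * (\<Sum>v\<in>V. (x v)\<^sup>2)"
    unfolding x(2) by simp
  then show ?thesis
    unfolding V_def by (rule mult_right_less_imp_less) (simp add: sum_nonneg)
qed

section \<open>Cuts that isolate no vertex\<close>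

lemma min_degree_le:
  assumes "finite (verts G)" "v \<in> verts G"
  shows "min_degree G \<le> vdegree G v"
  using assms by (simp add: min_degree_def)

lemma obtain_min_degree_vertex:
  assumes "finite (verts G)" "verts G \<noteq> {}"
  obtains v where "v \<in> verts G" "vdegree G v = min_degree G"
proof -
  have "min_degree G \<in> vdegree G ` verts G"
    unfolding min_degree_def using assms by (intro Min_in) auto
  then show thesis using that by auto
qed

lemma adjacent_delete_verts:
  "adjacent (delete_verts G C) u v \<longleftrightarrow> adjacent G u v \<and> u \<notin> C \<and> v \<notin> C"
  by (auto simp: adjacent_def delete_verts_def)

text \<open>The neighbourhood of a vertex of minimum degree is a vertex-cut: either only that vertex
  remains, or it is cut off from another one.\<close>

lemma vertex_connectivity_le_min_degree:
  assumes G: "simple_graph G" and ne: "verts G \<noteq> {}"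
  shows "vertex_connectivity G \<le> min_degree G"
proof -
  have fin: "finite (verts G)" using G by (simp add: simple_graph_def)
  obtain v where v: "v \<in> verts G" "vdegree G v = min_degree G"
    using obtain_min_degree_vertex[OF fin ne] .
  define N where "N = {u \<in> verts G. adjacent G v u}"
  have vN: "v \<notin> N" using simple_graph_adjacentD(3)[OF G] by (auto simp: N_def)
  have "vertex_cut G N"
  proof (cases "verts G - N = {v}")
    case True
    then show ?thesis by (auto simp: vertex_cut_def delete_verts_def N_def)
  next
    case False
    then obtain w where w: "w \<in> verts G - N" "w \<noteq> v" using v vN by auto
    have "\<not> adjacent (delete_verts G N) v u" for u
      using simple_graph_adjacentD(2)[OF G] by (auto simp: adjacent_delete_verts N_def)
    then have "\<not> reachable (delete_verts G N) v w"
      using w by (auto simp: reachable_def elim: converse_rtranclpE)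
    then have "disconnected_graph (delete_verts G N)"
      using v vN w by (auto simp: disconnected_graph_def delete_verts_def)
    then show ?thesis by (auto simp: vertex_cut_def N_def)
  qed
  moreover have "card N = min_degree G" using v by (simp add: N_def vdegree_def)
  ultimately show ?thesis
    unfolding vertex_connectivity_def by (intro Least_le) blast
qed

text \<open>\<open>A\<close> is a component left by a bad minimum cut and \<open>B\<close> the union
  of the others. The strict bounds allow the cut to be enlarged to \<delta> vertices from either
  part without exhausting it.\<close>

lemma not_super_connectedE:
  assumes G: "simple_graph G" and ne: "verts G \<noteq> {}" and super: "\<not> super_connected G"
  obtains C A B where "C \<union> A \<union> B = verts G" "C \<inter> A = {}" "C \<inter> B = {}" "A \<inter> B = {}"
    "card C \<le> min_degree G" "card A \<ge> 2" "card B \<ge> 2"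
    "min_degree G < card C + card A" "min_degree G < card C + card B"
    "\<And>a b. a \<in> A \<Longrightarrow> b \<in> B \<Longrightarrow> \<not> adjacent G a b"
proof -
  define V where "V = verts G"
  have fin: "finite V" using G by (simp add: V_def simple_graph_def)
  obtain C where "minimum_vertex_cut G C"
    and no_iso: "\<And>v. isolates G C v \<Longrightarrow> vdegree G v \<noteq> min_degree G"
    using super by (auto simp: super_connected_def)
  then have cut: "vertex_cut G C" and cardC: "card C \<le> min_degree G"
    using vertex_connectivity_le_min_degree[OF G ne] by (auto simp: minimum_vertex_cut_def)
  then have CV: "C \<subseteq> V" by (simp add: vertex_cut_def V_def)
  then have finC: "finite C" using fin finite_subset by blast
  define D where "D = delete_verts G C"
  have VD: "verts D = V - C" by (simp add: D_def delete_verts_def V_def)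
  \<comment> \<open>A vertex without neighbours outside \<open>C\<close> has degree at most
    \<open>card C\<close>, hence exactly the minimum degree, and \<open>C\<close> would isolate
    it.\<close>
  have nbr: "\<exists>u\<in>V - C. adjacent G v u" if v: "v \<in> V - C" for v
  proof (rule ccontr)
    assume no: "\<not> ?thesis"
    then have "{u \<in> V - C. adjacent D v u} = {}" by (auto simp: D_def adjacent_delete_verts)
    then have "vdegree D v = 0" unfolding vdegree_def VD by (simp only: card.empty)
    then have "isolates G C v"
      using v VD by (simp add: isolates_def D_def[symmetric])
    moreover have "vdegree G v \<le> card C"
      unfolding vdegree_def V_def[symmetric] by (rule card_mono[OF finC]) (use no in auto)
    then have "vdegree G v = min_degree G"
      using cardC min_degree_le[of G v] fin v by (auto simp: V_def)
    ultimately show False using no_iso by blast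
  qed
  have "card (V - C) \<noteq> 1"
  proof
    assume "card (V - C) = 1"
    then obtain v where v: "V - C = {v}" by (auto simp: card_1_singleton_iff)
    then show False using nbr[of v] simple_graph_adjacentD(3)[OF G, of v v] by auto
  qed
  then obtain s t where st: "s \<in> V - C" "t \<in> V - C" "\<not> reachable D s t"
    using cut by (auto simp: vertex_cut_def D_def[symmetric] VD disconnected_graph_def)
  define A where "A = {w \<in> V - C. reachable D s w}"
  define B where "B = V - C - A"
  have parts: "C \<union> A \<union> B = V" "C \<inter> A = {}" "C \<inter> B = {}" "A \<inter> B = {}"
    using CV by (auto simp: A_def B_def)
  have no_edge: "\<not> adjacent G a b" if "a \<in> A" "b \<in> B" for a b
  proof
    assume "adjacent G a b"
    then have "adjacent D a b" using that by (auto simp: D_def adjacent_delete_verts A_def B_def)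
    then have "reachable D s b"
      using that by (auto simp: A_def reachable_def)
    then show False using that by (auto simp: A_def B_def)
  qed
  \<comment> \<open>\<open>w\<close> and all its neighbours lie in \<open>C \<union> X\<close>,
    which gives at least \<delta> + 1 vertices.\<close>
  have size: "card X \<ge> 2 \<and> min_degree G < card C + card X"
    if X: "w \<in> X" "X \<subseteq> V - C" and closed: "\<And>u. u \<in> V - C \<Longrightarrow> adjacent G w u \<Longrightarrow> u \<in> X" for X w
  proof
    have finX: "finite X" using X fin by (auto intro: finite_subset)
    obtain u where "u \<in> V - C" "adjacent G w u" using nbr X by blast
    then have "{w, u} \<subseteq> X" "w \<noteq> u" using X closed simple_graph_adjacentD(3)[OF G] by blast+
    then show "card X \<ge> 2" using card_mono[OF finX, of "{w, u}"] by simp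
    define N where "N = {u \<in> V. adjacent G w u}"
    have "w \<notin> N" using simple_graph_adjacentD(3)[OF G, of w w] by (auto simp: N_def)
    then have "Suc (vdegree G w) = card (insert w N)"
      using fin by (simp add: N_def vdegree_def V_def)
    also have "\<dots> \<le> card (C \<union> X)"
      using X closed finC finX by (intro card_mono) (auto simp: N_def)
    also have "\<dots> \<le> card C + card X" by (rule card_Un_le)
    finally show "min_degree G < card C + card X"
      using min_degree_le[of G w] fin X by (auto simp: V_def)
  qed
  have "s \<in> A" using st by (simp add: A_def reachable_def)
  then have sizeA: "card A \<ge> 2 \<and> min_degree G < card C + card A"
    by (rule size) (use no_edge \<open>s \<in> A\<close> in \<open>auto simp: A_def B_def\<close>)
  have "t \<in> B" using st by (simp add: A_def B_def)
  then have sizeB: "card B \<ge> 2 \<and> min_degree G < card C + card B"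
    by (rule size) (use no_edge[of _ t] \<open>t \<in> B\<close> adjacent_commute[of G t] in \<open>unfold B_def, blast+\<close>)
  show thesis using that[of C A B] parts no_edge sizeA sizeB cardC by (simp add: V_def)
qed

text \<open>Taking all \<open>d\<close> vertices from \<open>A\<close> works unless it leaves a
  single vertex there while \<open>B\<close> has at least three.\<close>

lemma obtain_moved_vertices:
  assumes fin: "finite A" "finite B" and disj: "A \<inter> B = {}"
    and ge: "card A \<ge> 2" "card B \<ge> 2" "d < card A" "d < card B"
  obtains M where "M \<subseteq> A \<union> B" "card M = d" "A - M \<noteq> {}" "B - M \<noteq> {}" "split_sizes (A - M) (B - M)"
proof -
  note moved = that
  have part: thesis if i: "i + j = d" "i < card A" "j < card B"
    "card A - i = 2 \<or> card B - j = 2 \<or> card A - i \<ge> 3 \<and> card B - j \<ge> 3" for i j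
  proof -
    obtain M N where M: "M \<subseteq> A" "card M = i" and N: "N \<subseteq> B" "card N = j"
      using i by (metis less_imp_le obtain_subset_with_card_n)
    have finMN: "finite M" "finite N" using fin M N by (auto intro: finite_subset)
    have "A - (M \<union> N) = A - M" "B - (M \<union> N) = B - N" using M N disj by auto
    moreover have "card (A - M) = card A - i" "card (B - N) = card B - j"
      using M N finMN by (auto simp: card_Diff_subset)
    moreover have "card (M \<union> N) = d"
      using M N disj finMN i(1) by (subst card_Un_disjoint) auto
    ultimately show thesis
      using M N i by (intro moved[of "M \<union> N"]) (auto simp: split_sizes_def)
  qed
  show thesis
  proof (cases "card B = 2 \<or> card A - d \<ge> 2")
    case True
    then show thesis using ge by (intro part[of d 0]) auto
  next
    \<comment> \<open>Here \<open>card A = d + 1\<close>, so taking one vertex from \<open>B\<close>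
      instead leaves exactly two in \<open>A\<close>.\<close>
    case False
    then show thesis using ge by (intro part[of "d - 1" 1]) auto
  qed
qed

theorem theorem4p8:
  fixes G :: "'a sgraph" and n \<delta> :: nat and q\<^sub>2 :: real
  assumes "simple_graph G"
    and "connected_graph G"
    and "card (verts G) = n"
    and "min_degree G = \<delta>"
    and "q\<^sub>2 = Q_index (graph_join (complete_graph \<delta>)
                (disjoint_union (complete_graph 2) (complete_graph (n - \<delta> - 2))))"
    and "Q_index G \<ge> q\<^sub>2"
  shows "super_connected G"
proof (rule ccontr)
  assume not_super: "\<not> super_connected G"
  define V where "V = verts G"
  have fin: "finite V" using assms(1) by (simp add: V_def simple_graph_def)
  have ne: "verts G \<noteq> {}" using assms(2) by (simp add: connected_graph_def)
  obtain C A B where split: "C \<union> A \<union> B = V" "C \<inter> A = {}" "C \<inter> B = {}" "A \<inter> B = {}"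
    and sizes: "card C \<le> \<delta>" "card A \<ge> 2" "card B \<ge> 2" "\<delta> < card C + card A" "\<delta> < card C + card B"
    and no_edge: "\<And>a b. a \<in> A \<Longrightarrow> b \<in> B \<Longrightarrow> \<not> adjacent G a b"
    using not_super_connectedE[OF assms(1) ne not_super] assms(4) unfolding V_def by metis
  have finABC: "finite A" "finite B" "finite C" using fin split(1) by (auto intro: finite_subset)
  obtain M where M: "M \<subseteq> A \<union> B" "card M = \<delta> - card C" "A - M \<noteq> {}" "B - M \<noteq> {}"
    "split_sizes (A - M) (B - M)"
    using obtain_moved_vertices[OF finABC(1,2) split(4), of "\<delta> - card C"] sizes
    by (metis less_diff_conv2 add.commute)
  have finM: "finite M" using M(1) finABC by (auto intro: finite_subset)
  have cardCM: "card (C \<union> M) = \<delta>"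
    using M sizes split finM finABC by (subst card_Un_disjoint) auto
  \<comment> \<open>The filled-in graph is strictly larger than \<open>G\<close>. If nothing was
    moved, all its degrees exceed \<delta>; otherwise it joins a moved vertex to the opposite part,
    where \<open>G\<close> has no edge.\<close>
  have "\<exists>u v. (u, v) \<in> cross_free_pairs V (A - M) (B - M) \<and> \<not> adjacent G u v"
  proof (cases "M = {}")
    case True
    obtain w where w: "w \<in> V" "vdegree G w = \<delta>"
      using obtain_min_degree_vertex[OF _ ne] fin assms(4) unfolding V_def by metis
    define N where "N = {u \<in> V. adjacent G w u}"
    have N: "finite N" "card N = \<delta>" using w fin by (auto simp: N_def vdegree_def V_def)
    have cardC: "card C = \<delta>" using cardCM True by simp
    show ?thesis
    proof (rule ccontr)
      assume "\<not> ?thesis"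
      then have sub: "{v. (w, v) \<in> cross_free_pairs V A B} \<subseteq> N"
        using True by (auto simp: N_def cross_free_pairs_def)
      obtain X where X: "X \<subseteq> {v. (w, v) \<in> cross_free_pairs V A B}" "finite X" "card X > \<delta>"
      proof -
        \<comment> \<open>\<open>Y\<close> is the part containing \<open>w\<close>, or either part
          if \<open>w\<close> lies in \<open>C\<close>.\<close>
        have "\<exists>Y\<in>{A, B}. C \<union> Y - {w} \<subseteq> {v. (w, v) \<in> cross_free_pairs V A B}"
          using w(1) split by (auto simp: cross_free_pairs_def)
        then obtain Y where Y: "Y = A \<or> Y = B" "C \<union> Y - {w} \<subseteq> {v. (w, v) \<in> cross_free_pairs V A B}"
          by auto
        \<comment> \<open>Both parts have at least two vertices, so more than \<delta> remain after
          removing \<open>w\<close>.\<close>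
        have "card (C \<union> Y) \<ge> \<delta> + 2"
          using Y(1) split sizes cardC finABC by (auto simp: card_Un_disjoint)
        then have "card (C \<union> Y - {w}) > \<delta>" using card_Diff_singleton_if[of "C \<union> Y" w] by auto
        then show thesis using that[OF Y(2)] Y(1) finABC by auto
      qed
      have "card X \<le> card N" using X sub N by (intro card_mono) auto
      then show False using X N by simp
    qed
  next
    case False
    then obtain m where m: "m \<in> M" by auto
    show ?thesis
    proof (cases "m \<in> A")
      case True
      obtain b where "b \<in> B - M" using M(4) by auto
      then show ?thesis using True m split no_edge[of m b]
        by (intro exI[of _ m] exI[of _ b]) (auto simp: cross_free_pairs_def)
    next
      case False
      then have "m \<in> B" using m M(1) by auto
      obtain a where "a \<in> A - M" using M(3) by auto
      then show ?thesis using \<open>m \<in> B\<close> m split no_edge[of a m]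
        by (intro exI[of _ a] exI[of _ m]) (auto simp: cross_free_pairs_def)
    qed
  qed
  then obtain u v where "(u, v) \<in> cross_free_pairs (verts G) (A - M) (B - M)" "\<not> adjacent G u v"
    by (auto simp: V_def)
  then have "Q_index G < Q_index (extremal_graph (card (C \<union> M)) (card (verts G) - card (C \<union> M) - 2))"
    by (intro Q_index_less_extremal[OF assms(1,2) _ _ _ _ M(5)])
      (use split M(1) no_edge in \<open>auto simp: V_def\<close>)
  then show False
    using assms(3,5,6) by (simp add: cardCM extremal_graph_def)
qed

end
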